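(* Let $\mathfrak{p},\mathfrak{q}\in\mathbb{C}$ and let $\alpha_n=\alpha_n(t)$, $\beta_n=\beta_n(t)$ $(n\ge 1)$ be differentiable complex-valued functions of $t$ with $\alpha_1(t)= 0$ and $\beta_n(t)\neq 0$ for all $n\ge 1$; put $\beta_0(t)=1$, $\alpha_0(t)=-1$, and $\gamma_n=\alpha_{n+1}+\beta_n$ for $n\geq 1$. Let $\mathcal{H}=\mathcal{H}(t)$ be the infinite Hessenberg matrix and $\mathcal{F}=\mathcal{F}(t)$ the infinite tridiagonal matrix $$\mathcal{H}=\begin{pmatrix}\gamma_1&\gamma_2&\gamma_3&\cdots&\gamma_n&\cdots\\ \alpha_2&\gamma_2&\gamma_3&\cdots&\gamma_n&\cdots\\ 0&\alpha_3&\gamma_3&\cdots&\gamma_n&\cdots\\ \vdots&\ddots&\ddots&\ddots&\vdots&\\ 0&\cdots&0&\alpha_n&\gamma_n&\cdots\\ \vdots&&\vdots&\ddots&\ddots&\ddots\end{pmatrix},\qquad \mathcal{F}=\begin{pmatrix}\mathfrak{f}_1&\mathfrak{h}_1&0&\cdots\\ \mathfrak{e}_2&\mathfrak{f}_2&\mathfrak{h}_2&\ddots\\ 0&\mathfrak{e}_3&\mathfrak{f}_3&\ddots\\ \vdots&\ddots&\ddots&\ddots\end{pmatrix},$$ i.e. $\mathcal{H}_{i,j}=\gamma_j$ for $j\ge i$, $\mathcal{H}_{i,i-1}=\alpha_i$ for $i\geq 2$, $\mathcal{H}_{i,j}=0$ for $j<i-1$, and $\mathcal{F}_{k,k}=\mathfrak{f}_k$,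 $\mathcal{F}_{k,k+1}=\mathfrak{h}_k$ for $k\ge 1$, $\mathcal{F}_{k,k-1}=\mathfrak{e}_k$ for $k\ge 2$, all other entries $0$, where $$\mathfrak{e}_k=-\mathfrak{p}\,\alpha_k,\qquad \mathfrak{f}_k=\mathfrak{p}\,\alpha_k+\frac{\mathfrak{q}}{\gamma_k-\alpha_{k+1}},\qquad \mathfrak{h}_k=-\frac{\mathfrak{q}}{\gamma_k-\alpha_{k+1}}.$$ Then $\{\mathcal{H},\mathcal{F}\}$ is a Lax pair for the extended relativistic Toda lattice equations $$\dot\alpha_n=\mathfrak{p}\,\alpha_n(\alpha_{n-1}+\beta_{n-1}-\alpha_{n+1}-\beta_n)+\mathfrak{q}\,\alpha_n\left(\frac{1}{\beta_{n-1}}-\frac{1}{\beta_n}\right),\quad n\ge 1,$$ $$\dot\gamma_n=\mathfrak{p}\,(\alpha_n\gamma_n-\alpha_{n+1}\gamma_{n+1})+\mathfrak{q}\left(\frac{\alpha_{n+1}}{\beta_n}-\frac{\alpha_n}{\beta_{n-1}}\right),\quad n\ge 1,$$ that is, this system of equations is represented by (is equivalent to) the matrix equation $$\dot{\mathcal{H}}=[\mathcal{H},\mathcal{F}]=\mathcal{H}\mathcal{F}-\mathcal{F}\mathcal{H}.$$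
   Context: A dot denotes $d/dt$, applied entrywise to matrices. A pair $\{\mathcal{H},\mathcal{F}\}$ is called a Lax pair for a system of differential equations if the system can be represented in the matrix form $\dot{\mathcal{H}}=\mathcal{H}\mathcal{F}-\mathcal{F}\mathcal{H}$. Infinite matrices are indexed by $i,j\ge 1$; since $\mathcal{F}$ is tridiagonal, every entry of $\mathcal{H}\mathcal{F}$ and $\mathcal{F}\mathcal{H}$ is a finite sum. *)

theory Defs
  imports "HOL-Analysis.Analysis"
begin

text \<open>
  Infinite matrices are functions of type \<open>nat \<Rightarrow> nat \<Rightarrow> complex\<close>, of which only the entries with
  both indices at least 1 are meaningful.
\<close>

definition hessenberg :: "(nat \<Rightarrow> complex) \<Rightarrow> (nat \<Rightarrow> complex) \<Rightarrow> nat \<Rightarrow> nat \<Rightarrow> complex" where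
  "hessenberg a g i j = (if i \<le> j then g j else if i = Suc j then a i else 0)"

definition tridiagonal ::
  "(nat \<Rightarrow> complex) \<Rightarrow> (nat \<Rightarrow> complex) \<Rightarrow> (nat \<Rightarrow> complex) \<Rightarrow> nat \<Rightarrow> nat \<Rightarrow> complex" where
  "tridiagonal e f h i j =
     (if j = i then f i else if j = Suc i then h i else if i = Suc j then e i else 0)"

definition toda_F ::
  "complex \<Rightarrow> complex \<Rightarrow> (nat \<Rightarrow> complex) \<Rightarrow> (nat \<Rightarrow> complex) \<Rightarrow> nat \<Rightarrow> nat \<Rightarrow> complex" where
  "toda_F p q a g =
     tridiagonal (\<lambda>k. - p * a k)
                 (\<lambda>k. p * a k + q / (g k - a (k + 1)))
                 (\<lambda>k. - (q / (g k - a (k + 1))))"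

definition imat_mult ::
  "(nat \<Rightarrow> nat \<Rightarrow> complex) \<Rightarrow> (nat \<Rightarrow> nat \<Rightarrow> complex) \<Rightarrow> nat \<Rightarrow> nat \<Rightarrow> complex" where
  "imat_mult A B i j = (\<Sum>\<^sub>\<infinity>k\<in>{1..}. A i k * B k j)"

text \<open>If one factor is tridiagonal, every entry of the product is a finite sum.\<close>

lemma imat_mult_tridiagonal_right:
  "imat_mult A (tridiagonal e f h) i j
     = (\<Sum>k\<in>{max 1 (j - 1)..j + 1}. A i k * tridiagonal e f h k j)"
proof -
  have "imat_mult A (tridiagonal e f h) i j
      = (\<Sum>\<^sub>\<infinity>k\<in>{max 1 (j - 1)..j + 1}. A i k * tridiagonal e f h k j)"
    unfolding imat_mult_def
    by (rule infsum_cong_neutral) (auto simp: tridiagonal_def)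
  then show ?thesis by simp
qed

lemma imat_mult_tridiagonal_left:
  "imat_mult (tridiagonal e f h) B i j
     = (\<Sum>k\<in>{max 1 (i - 1)..i + 1}. tridiagonal e f h i k * B k j)"
proof -
  have "imat_mult (tridiagonal e f h) B i j
      = (\<Sum>\<^sub>\<infinity>k\<in>{max 1 (i - 1)..i + 1}. tridiagonal e f h i k * B k j)"
    unfolding imat_mult_def
    by (rule infsum_cong_neutral) (auto simp: tridiagonal_def)
  then show ?thesis by simp
qed

definition imat_commutator ::
  "(nat \<Rightarrow> nat \<Rightarrow> complex) \<Rightarrow> (nat \<Rightarrow> nat \<Rightarrow> complex) \<Rightarrow> nat \<Rightarrow> nat \<Rightarrow> complex" where
  "imat_commutator A B i j = imat_mult A B i j - imat_mult B A i j"

definition lax_equation ::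
  "real set \<Rightarrow> (real \<Rightarrow> nat \<Rightarrow> nat \<Rightarrow> complex) \<Rightarrow> (real \<Rightarrow> nat \<Rightarrow> nat \<Rightarrow> complex) \<Rightarrow> bool" where
  "lax_equation T H F \<longleftrightarrow>
     (\<forall>t\<in>T. \<forall>i\<ge>1. \<forall>j\<ge>1.
        ((\<lambda>s. H s i j) has_vector_derivative imat_commutator (H t) (F t) i j) (at t within T))"

text \<open>The argument \<open>S\<close> is the assertion that the given system of differential equations
  holds for all times in \<open>T\<close>. Derivatives are taken within \<open>T\<close>, hence one-sided at an endpoint in \<open>T\<close>.\<close>

definition lax_pair ::
  "real set \<Rightarrow> (real \<Rightarrow> nat \<Rightarrow> nat \<Rightarrow> complex) \<Rightarrow> (real \<Rightarrow> nat \<Rightarrow> nat \<Rightarrow> complex) \<Rightarrow> bool \<Rightarrow> bool" where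
  "lax_pair T H F S \<longleftrightarrow> (S \<longleftrightarrow> lax_equation T H F)"

definition extended_relativistic_toda ::
  "real set \<Rightarrow> complex \<Rightarrow> complex \<Rightarrow> (nat \<Rightarrow> real \<Rightarrow> complex) \<Rightarrow> (nat \<Rightarrow> real \<Rightarrow> complex)
    \<Rightarrow> (nat \<Rightarrow> real \<Rightarrow> complex) \<Rightarrow> bool" where
  "extended_relativistic_toda T p q \<alpha> \<beta> \<gamma> \<longleftrightarrow>
     (\<forall>t\<in>T. \<forall>n\<ge>1.
        (\<alpha> n has_vector_derivative
           (p * \<alpha> n t * (\<alpha> (n - 1) t + \<beta> (n - 1) t - \<alpha> (n + 1) t - \<beta> n t)
            + q * \<alpha> n t * (1 / \<beta> (n - 1) t - 1 / \<beta> n t))) (at t within T)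
      \<and> (\<gamma> n has_vector_derivative
           (p * (\<alpha> n t * \<gamma> n t - \<alpha> (n + 1) t * \<gamma> (n + 1) t)
            + q * (\<alpha> (n + 1) t / \<beta> n t - \<alpha> n t / \<beta> (n - 1) t))) (at t within T))"

end

theory Submission imports Defs begin

text \<open>Both directions follow from one computation (\<open>toda_commutator_entry\<close>),
  valid at each fixed time: the entry (i,j) of HF - FH is the right-hand side for \<gamma> j on and
  above the diagonal, that for \<alpha> i just below it, and 0 further down. Since H has \<gamma> j,
  \<alpha> i and 0 in these places, the Lax equation, read entry by entry, is the Toda system for
  \<gamma> n with n \<ge> 1 and \<alpha> n with n \<ge> 2; the equation for \<alpha> 1 reads 0 = 0.
  What makes the entries above the diagonal independent of the row is that the rows of F sum to
  zero.\<close>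

text \<open>Column 1 is separate because index 0 lies outside the matrix, although
  \<open>tridiagonal\<close> takes a value there.\<close>

lemma imat_mult_tridiagonal_right_entry:
  assumes "j \<ge> 1"
  shows "imat_mult A (tridiagonal e f h) i j
    = (if j = 1 then 0 else A i (j - 1) * h (j - 1)) + A i j * f j + A i (Suc j) * e (Suc j)"
proof (cases "j = 1")
  case True
  have "{1..2::nat} = {1, 2}" by auto
  with True show ?thesis
    unfolding imat_mult_tridiagonal_right by (simp add: tridiagonal_def numeral_2_eq_2)
next
  case False
  with assms obtain m where j: "j = Suc (Suc m)"
    by (metis One_nat_def not0_implies_Suc not_one_le_zero)
  have "{max 1 (j - 1)..j + 1} = {Suc m, Suc (Suc m), Suc (Suc (Suc m))}"
    using j by auto
  then show ?thesis
    unfolding imat_mult_tridiagonal_right by (simp add: tridiagonal_def j)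
qed

lemma imat_mult_tridiagonal_left_entry:
  assumes "i \<ge> 1"
  shows "imat_mult (tridiagonal e f h) B i j
    = (if i = 1 then 0 else e i * B (i - 1) j) + f i * B i j + h i * B (Suc i) j"
proof (cases "i = 1")
  case True
  have "{1..2::nat} = {1, 2}" by auto
  with True show ?thesis
    unfolding imat_mult_tridiagonal_left by (simp add: tridiagonal_def numeral_2_eq_2)
next
  case False
  with assms obtain m where i: "i = Suc (Suc m)"
    by (metis One_nat_def not0_implies_Suc not_one_le_zero)
  have "{max 1 (i - 1)..i + 1} = {Suc m, Suc (Suc m), Suc (Suc (Suc m))}"
    using i by auto
  then show ?thesis
    unfolding imat_mult_tridiagonal_left by (simp add: tridiagonal_def i)
qed

lemma toda_commutator_entry:
  fixes p q :: complex and a b g :: "nat \<Rightarrow> complex"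
  assumes a1: "a 1 = 0"
    and b: "\<And>n. n \<ge> 1 \<Longrightarrow> b n \<noteq> 0"
    and g: "\<And>n. n \<ge> 1 \<Longrightarrow> g n = a (n + 1) + b n"
    and i: "i \<ge> 1" and j: "j \<ge> 1"
  shows "imat_commutator (hessenberg a g) (toda_F p q a g) i j =
    (if i \<le> j then
       p * (a j * g j - a (j + 1) * g (j + 1)) + q * (a (j + 1) / b j - a j / b (j - 1))
     else if i = Suc j then
       p * a i * (a (i - 1) + b (i - 1) - a (i + 1) - b i) + q * a i * (1 / b (i - 1) - 1 / b i)
     else 0)"
proof -
  \<comment> \<open>So the denominators in \<open>toda_F\<close> are the b n.\<close>
  have r: "g n - a (Suc n) = b n" if "n \<ge> 1" for n
    using g[OF that] by simp
  note comm = imat_commutator_def toda_F_def hessenberg_def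
    imat_mult_tridiagonal_right_entry imat_mult_tridiagonal_left_entry
  consider "i < j" | "i = j" | "i = Suc j" | "i = Suc (Suc j)" | "i > Suc (Suc j)"
    by linarith
  then show ?thesis
  proof cases
    case 1
    then obtain m where m: "j = Suc m" "m \<ge> 1" using i by (cases j) auto
    \<comment> \<open>The summand q does not depend on n, so it cancels between the columns j and m
      = j - 1.\<close>
    have quot: "g n * (q / b n) = q + q * (a (n + 1) / b n)" if "n \<ge> 1" for n
      using b[OF that] g[OF that] by (simp add: field_simps)
    \<comment> \<open>Rows i and i + 1 of H, and row i - 1 if i > 1, all have the entry g j in
      column j, so FH contributes g j times the sum of row i of F. This sum is 0, in row 1 because a
      1 = 0; only HF remains.\<close>
    have "imat_commutator (hessenberg a g) (toda_F p q a g) i j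
      = p * (a j * g j - a (j + 1) * g (j + 1)) + g j * (q / b j) - g m * (q / b m)"
      using 1 m i a1 by (auto simp: comm r algebra_simps)
    also have "\<dots> = p * (a j * g j - a (j + 1) * g (j + 1)) + q * (a (j + 1) / b j - a j / b m)"
      using quot[OF j] quot[OF m(2)] m by (simp add: algebra_simps)
    finally show ?thesis using 1 m by simp
  next
    case 2
    \<comment> \<open>For j = 1 the term with b 0 has the factor a 1 = 0, matching the absent
      neighbour in HF.\<close>
    then show ?thesis using a1 j g[of "j - 1"]
      by (cases "j = 1") (auto simp: comm r algebra_simps)
  next
    case 3
    then show ?thesis using a1 j g[of i] g[of j] by (auto simp: comm r algebra_simps)
  next
    case 4
    \<comment> \<open>Each product has the single term - p * a (j + 1) * a (j + 2), and these
      cancel.\<close>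
    then show ?thesis using j by (auto simp: comm)
  next
    case 5
    \<comment> \<open>Here both products vanish, since their nonzero entries reach only to the
      second subdiagonal.\<close>
    then show ?thesis using j by (auto simp: comm)
  qed
qed

theorem theorem2:
  fixes p q :: complex
    and T :: "real set"
    and \<alpha> \<beta> \<gamma> :: "nat \<Rightarrow> real \<Rightarrow> complex"
  assumes "is_interval T" and "interior T \<noteq> {}"
    and "\<And>n. n \<ge> 1 \<Longrightarrow> \<alpha> n differentiable_on T"
    and "\<And>n. n \<ge> 1 \<Longrightarrow> \<beta> n differentiable_on T"
    and "\<And>t. t \<in> T \<Longrightarrow> \<alpha> 1 t = 0"
    and "\<And>n t. n \<ge> 1 \<Longrightarrow> t \<in> T \<Longrightarrow> \<beta> n t \<noteq> 0"
    and "\<And>t. t \<in> T \<Longrightarrow> \<beta> 0 t = 1"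
    and "\<And>t. t \<in> T \<Longrightarrow> \<alpha> 0 t = -1"
    and "\<And>n t. n \<ge> 1 \<Longrightarrow> t \<in> T \<Longrightarrow> \<gamma> n t = \<alpha> (n + 1) t + \<beta> n t"
  shows "lax_pair T
           (\<lambda>t. hessenberg (\<lambda>n. \<alpha> n t) (\<lambda>n. \<gamma> n t))
           (\<lambda>t. toda_F p q (\<lambda>n. \<alpha> n t) (\<lambda>n. \<gamma> n t))
           (extended_relativistic_toda T p q \<alpha> \<beta> \<gamma>)"
proof -
  define A where "A n t = p * \<alpha> n t * (\<alpha> (n - 1) t + \<beta> (n - 1) t - \<alpha> (n + 1) t - \<beta> n t)
    + q * \<alpha> n t * (1 / \<beta> (n - 1) t - 1 / \<beta> n t)" for n t
  define G where "G n t = p * (\<alpha> n t * \<gamma> n t - \<alpha> (n + 1) t * \<gamma> (n + 1) t)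
    + q * (\<alpha> (n + 1) t / \<beta> n t - \<alpha> n t / \<beta> (n - 1) t)" for n t
  let ?H = "\<lambda>t. hessenberg (\<lambda>n. \<alpha> n t) (\<lambda>n. \<gamma> n t)"
  let ?F = "\<lambda>t. toda_F p q (\<lambda>n. \<alpha> n t) (\<lambda>n. \<gamma> n t)"
  have entry: "imat_commutator (?H t) (?F t) i j =
      (if i \<le> j then G j t else if i = Suc j then A i t else 0)"
    if "t \<in> T" "i \<ge> 1" "j \<ge> 1" for t i j
    unfolding A_def G_def
    by (rule toda_commutator_entry) (use assms(5,6,9) that in auto)
  have toda: "extended_relativistic_toda T p q \<alpha> \<beta> \<gamma> \<longleftrightarrow>
      (\<forall>t\<in>T. \<forall>n\<ge>1. (\<alpha> n has_vector_derivative A n t) (at t within T)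
                  \<and> (\<gamma> n has_vector_derivative G n t) (at t within T))"
    unfolding extended_relativistic_toda_def A_def G_def ..
  show ?thesis
    unfolding lax_pair_def
  proof
    assume S: "extended_relativistic_toda T p q \<alpha> \<beta> \<gamma>"
    show "lax_equation T ?H ?F"
      unfolding lax_equation_def
    proof (intro ballI allI impI)
      fix t and i j :: nat
      assume t: "t \<in> T" and ij: "1 \<le> i" "1 \<le> j"
      consider "i \<le> j" | "i = Suc j" | "i > Suc j" by linarith
      then show "((\<lambda>s. ?H s i j) has_vector_derivative imat_commutator (?H t) (?F t) i j)
          (at t within T)"
        using S t ij unfolding toda entry[OF t ij] by cases (simp_all add: hessenberg_def)
    qed
  next
    assume L: "lax_equation T ?H ?F"
    have D: "((\<lambda>s. ?H s i j) has_vector_derivative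
        (if i \<le> j then G j t else if i = Suc j then A i t else 0)) (at t within T)"
      if "t \<in> T" "i \<ge> 1" "j \<ge> 1" for t i j
      unfolding entry[OF that, symmetric] using L that unfolding lax_equation_def by blast
    show "extended_relativistic_toda T p q \<alpha> \<beta> \<gamma>"
      unfolding toda
    proof (intro ballI allI impI conjI)
      fix t n
      assume t: "t \<in> T" and n: "1 \<le> (n::nat)"
      show "(\<gamma> n has_vector_derivative G n t) (at t within T)"
        using D[OF t n n] by (simp add: hessenberg_def)
      show "(\<alpha> n has_vector_derivative A n t) (at t within T)"
      proof (cases "n = 1")
        case True
        \<comment> \<open>\<open>\<alpha> 1\<close> does not occur in the matrix; its equation holds because \<open>\<alpha> 1\<close> vanishes on \<open>T\<close>.\<close>
        have "((\<lambda>_. 0) has_vector_derivative A 1 t) (at t within T)"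
          using assms(5)[OF t] by (simp add: A_def)
        then have "(\<alpha> 1 has_vector_derivative A 1 t) (at t within T)"
          by (rule has_vector_derivative_transform[OF t, rotated]) (rule assms(5))
        then show ?thesis using True by simp
      next
        case False
        \<comment> \<open>For n \<ge> 2, \<alpha> n is the entry of H in row n and column n -
          1.\<close>
        then obtain m where "n = Suc m" "m \<ge> 1" using n by (cases n) auto
        then show ?thesis using D[OF t n, of m] by (simp add: hessenberg_def)
      qed
    qed
  qed
qed

end
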